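(* Let $(N,v,\Gamma)$ be an organisational situation. Then the average forest measure is component feasible, i.e., for every connected component $C$ of $\Gamma$, $$\sum_{i\in C}AF_i(N,v,\Gamma)\le v(C).$$
   Context: Let $N=\{1,\dots,n\}$, $n\ge 2$. A TU game on $N$ is a function $v:2^N\to\mathbb{R}$ with $v(\emptyset)=0$; it is superadditive if $v(S\cup Q)\ge v(S)+v(Q)$ for all disjoint $S,Q\subseteq N$. A digraph $\Gamma=(N,A)$ on $N$ has arc set $A\subseteq\{(i,j)\mid i,j\in N,\ i\ne j\}$. A circuit is a directed cycle (of length at least 2). Connectedness and connected components of a digraph are understood in the weak sense (arc directions ignored). If there is a directed path from $i$ to $j$ (with at least one arc), $j$ is a successor of $i$ and $i$ is a predecessor of $j$; if $(i,j)\in A$, they are immediate successor/predecessor. $S^\Gamma(i)$ and $\widehat S^\Gamma(i)$ denote the sets of successors and immediate successors of $i$, and $\bar S^\Gamma(i)=S^\Gamma(i)\cup\{i\}$. An arborescence is a weakly connected circuit-free digraph having a unique root (a node from which every other node is reachable by a directed path) such that the directed path from the root to any other node is unique (a single node is an arborescence). A forest is a digraph whose connected components are arborescences. A spanning forest of $\Gamma=(N,A)$ is a forest $(N,A')$ with $A'\subseteq A$; it is maximal if adding to it any other arc of $A$ does not give a forest. $\mathcal{F}^\Gamma$ denotes the set of maximal spanning forests of $\Gamma$. An organisational situation $(N,v,\Gamma)$ consists of a superadditive game $v$ on $N$ and a circuit-free digraph $\Gamma$ on $N$. For $F\in\mathcal{F}^\Gamma$ and $i\in N$ set $$m_i^{(v,\Gamma)}(F)=v(\bar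 S^F(i))-\sum_{j\in\widehat S^F(i)}v(\bar S^F(j)).$$ The average forest measure is $$AF_i(N,v,\Gamma)=\frac{1}{|\mathcal{F}^\Gamma|}\sum_{F\in\mathcal{F}^\Gamma}m_i^{(v,\Gamma)}(F),\qquad i\in N.$$ *)

theory Defs
  imports Complex_Main "Graph_Theory.Digraph_Component"
begin

text \<open>A game on \<open>N\<close> is a total function on sets; only its values on subsets of \<open>N\<close> matter.\<close>

definition superadditive :: "'a set \<Rightarrow> ('a set \<Rightarrow> real) \<Rightarrow> bool" where
  "superadditive N v \<longleftrightarrow>
     (\<forall>S Q. S \<subseteq> N \<longrightarrow> Q \<subseteq> N \<longrightarrow> S \<inter> Q = {} \<longrightarrow> v (S \<union> Q) \<ge> v S + v Q)"

definition tu_game :: "('a set \<Rightarrow> real) \<Rightarrow> bool" where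
  "tu_game v \<longleftrightarrow> v {} = 0"

text \<open>
  The library notion \<open>cycle\<close> is a directed cycle, possibly a loop; in a loop-free digraph
  cycles have length at least 2. \<open>connected\<close> is weak connectedness (of a nonempty digraph).
  The library's \<open>forest\<close> and \<open>tree\<close> do not restrict in-degrees and are not used here.
\<close>

definition circuit_free :: "('a, 'b) pre_digraph \<Rightarrow> bool" where
  "circuit_free G \<longleftrightarrow> \<not> (\<exists>p. pre_digraph.cycle G p)"

definition is_root :: "('a, 'b) pre_digraph \<Rightarrow> 'a \<Rightarrow> bool" where
  "is_root G r \<longleftrightarrow> r \<in> verts G \<and> (\<forall>i \<in> verts G - {r}. r \<rightarrow>\<^sup>*\<^bsub>G\<^esub> i)"

definition arborescence :: "('a, 'b) pre_digraph \<Rightarrow> bool" where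
  "arborescence G \<longleftrightarrow> connected G \<and> circuit_free G \<and> (\<exists>!r. is_root G r) \<and>
     (\<forall>r. is_root G r \<longrightarrow> (\<forall>i \<in> verts G - {r}. \<exists>!p. pre_digraph.apath G r p i))"

definition components :: "('a, 'b) pre_digraph \<Rightarrow> ('a, 'b) pre_digraph set" where
  "components G = {H. pre_digraph.max_subgraph G connected H}"

definition directed_forest :: "('a, 'b) pre_digraph \<Rightarrow> bool" where
  "directed_forest G \<longleftrightarrow> (\<forall>H \<in> components G. arborescence H)"

definition spanning_forest :: "'a pair_pre_digraph \<Rightarrow> 'a pair_pre_digraph \<Rightarrow> bool" where
  "spanning_forest F G \<longleftrightarrow> spanning (with_proj F) (with_proj G) \<and> directed_forest (with_proj F)"

definition max_spanning_forests :: "'a pair_pre_digraph \<Rightarrow> 'a pair_pre_digraph set" where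
  "max_spanning_forests G = {F. spanning_forest F G \<and>
     (\<forall>a \<in> parcs G - parcs F. \<not> directed_forest (with_proj (F\<lparr>parcs := insert a (parcs F)\<rparr>)))}"

definition successors :: "'a pair_pre_digraph \<Rightarrow> 'a \<Rightarrow> 'a set" where
  "successors G i = {j. i \<rightarrow>\<^sup>+\<^bsub>with_proj G\<^esub> j}"

definition immediate_successors :: "'a pair_pre_digraph \<Rightarrow> 'a \<Rightarrow> 'a set" where
  "immediate_successors G i = {j. (i, j) \<in> parcs G}"

definition closed_successors :: "'a pair_pre_digraph \<Rightarrow> 'a \<Rightarrow> 'a set" where
  "closed_successors G i = successors G i \<union> {i}"

definition marginal :: "('a set \<Rightarrow> real) \<Rightarrow> 'a pair_pre_digraph \<Rightarrow> 'a \<Rightarrow> real" where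
  "marginal v F i =
     v (closed_successors F i) - (\<Sum>j \<in> immediate_successors F i. v (closed_successors F j))"

definition average_forest_measure :: "('a set \<Rightarrow> real) \<Rightarrow> 'a pair_pre_digraph \<Rightarrow> 'a \<Rightarrow> real" where
  "average_forest_measure v G i =
     1 / real (card (max_spanning_forests G)) * (\<Sum>F \<in> max_spanning_forests G. marginal v F i)"

definition organisational_situation ::
    "'a set \<Rightarrow> ('a set \<Rightarrow> real) \<Rightarrow> 'a pair_pre_digraph \<Rightarrow> bool" where
  "organisational_situation N v G \<longleftrightarrow>
     tu_game v \<and> superadditive N v \<and>
     pair_digraph G \<and> pverts G = N \<and> circuit_free (with_proj G)"

end

theory Submission
  imports Defs
begin

text \<open>
  For a spanning forest \<open>F\<close>, every term \<open>v (closed_successors F j)\<close> with \<open>j\<close> not a root of \<open>F\<close> is subtracted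
  exactly once in the sum of the marginals, at the only immediate predecessor of \<open>j\<close>, which lies
  in the same component of \<open>\<Gamma>\<close>. So the marginals of a component \<open>C\<close> sum to the total worth of the
  trees of \<open>F\<close> inside \<open>C\<close>. These trees partition \<open>C\<close>, and superadditivity bounds their total worth
  by \<open>v C\<close>. The average inherits the bound because maximal spanning forests exist
  (without one it would be the junk value 0, which may exceed \<open>v C\<close>).
\<close>

section \<open>Weak components\<close>

text \<open>\<open>components\<close> is defined by maximality. This is the explicit form of its
  members: the subgraph induced on everything that \<open>x\<close> reaches when directions are
  ignored.\<close>

definition weak_component :: "('a, 'b) pre_digraph \<Rightarrow> 'a \<Rightarrow> ('a, 'b) pre_digraph" where
  "weak_component G x = G \<restriction> {y. x \<rightarrow>\<^sup>*\<^bsub>mk_symmetric G\<^esub> y}"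

context wf_digraph
begin

lemma subgraph_weak_component: "subgraph (weak_component G x) G"
  unfolding weak_component_def
  by (rule subgraph_induce_subgraphI, auto elim: reachable_in_vertsE)

lemma verts_weak_component: "verts (weak_component G x) = {y. x \<rightarrow>\<^sup>*\<^bsub>mk_symmetric G\<^esub> y}"
  by (simp add: weak_component_def)

lemma in_weak_component_self:
  assumes "x \<in> verts G"
  shows "x \<in> verts (weak_component G x)"
proof -
  interpret S: pair_wf_digraph "mk_symmetric G" ..
  show ?thesis using assms by (simp add: verts_weak_component)
qed

text \<open>Each arc can be traversed both ways in \<open>mk_symmetric G\<close>, so reaching one
  end from \<open>x\<close> means reaching the other.\<close>

lemma weak_component_closed:
  assumes "e \<in> arcs G"
  shows "tail G e \<in> verts (weak_component G x) \<longleftrightarrow> head G e \<in> verts (weak_component G x)"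
proof -
  interpret S: pair_wf_digraph "mk_symmetric G" ..
  have "(tail G e, head G e) \<in> parcs (mk_symmetric G)"
    "(head G e, tail G e) \<in> parcs (mk_symmetric G)"
    using assms by (auto simp: parcs_mk_symmetric)
  then show ?thesis
    unfolding verts_weak_component by (blast intro: S.reachable_adj_trans)
qed

lemma arc_in_weak_component:
  assumes "e \<in> arcs G" "head G e \<in> verts (weak_component G x)"
  shows "e \<in> arcs (weak_component G x)"
  using assms weak_component_closed[OF assms(1), of x]
  by (simp add: weak_component_def)

lemma connected_weak_component:
  assumes "x \<in> verts G"
  shows "connected (weak_component G x)"
proof -
  let ?H = "weak_component G x"
  interpret S: pair_wf_digraph "mk_symmetric G" ..
  interpret H: wf_digraph ?H using subgraph_weak_component by blast
  interpret HS: pair_wf_digraph "mk_symmetric ?H" ..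
  \<comment> \<open>A symmetric walk from \<open>x\<close> only meets vertices reachable from
    \<open>x\<close>, so the arcs it uses all survive in the induced subgraph.\<close>
  have sub: "x \<rightarrow>\<^sup>*\<^bsub>mk_symmetric ?H\<^esub> y" if "x \<rightarrow>\<^sup>*\<^bsub>mk_symmetric G\<^esub> y" for y
    using that
  proof (induct rule: S.reachable_induct)
    case base
    then show ?case using assms by (auto simp: verts_weak_component)
  next
    case (step y z)
    have "(y, z) \<in> parcs (mk_symmetric ?H)"
    proof -
      have z: "x \<rightarrow>\<^sup>*\<^bsub>mk_symmetric G\<^esub> z" using step(1,2) by (rule S.reachable_adj_trans)
      from step(2) obtain e where e: "e \<in> arcs G"
        "(y = tail G e \<and> z = head G e) \<or> (z = tail G e \<and> y = head G e)"
        by (auto simp: parcs_mk_symmetric)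
      then have "e \<in> arcs ?H"
        using step(1) z by (auto intro!: arc_in_weak_component simp: verts_weak_component)
      then show ?thesis using e(2) by (auto simp: parcs_mk_symmetric weak_component_def)
    qed
    with step(3) show ?case by (rule HS.reachable_adj_trans)
  qed
  have "u \<rightarrow>\<^sup>*\<^bsub>mk_symmetric ?H\<^esub> v" if "u \<in> verts ?H" "v \<in> verts ?H" for u v
  proof -
    have "x \<rightarrow>\<^sup>*\<^bsub>mk_symmetric ?H\<^esub> u" "x \<rightarrow>\<^sup>*\<^bsub>mk_symmetric ?H\<^esub> v"
      using that sub by (simp_all add: verts_weak_component)
    \<comment> \<open>Symmetry reverses the walk from \<open>x\<close> to \<open>u\<close>, which
      gives a walk from \<open>u\<close> to \<open>v\<close> through \<open>x\<close>.\<close>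
    from symmetric_reachable[OF symmetric_mk_symmetric this(1)] this(2)
    show ?thesis by (rule HS.reachable_trans)
  qed
  moreover have "x \<in> verts ?H" using assms by (rule in_weak_component_self)
  ultimately show ?thesis unfolding connected_def by (intro strongly_connectedI) auto
qed

lemma connected_subgraph_weak_component:
  assumes "subgraph H G" "connected H" "x \<in> verts H"
  shows "subgraph H (weak_component G x)"
proof (rule subgraphI)
  interpret H: wf_digraph H using assms(1) by blast
  show verts: "verts H \<subseteq> verts (weak_component G x)"
  proof
    fix y assume "y \<in> verts H"
    with assms(2,3) have "x \<rightarrow>\<^sup>*\<^bsub>mk_symmetric H\<^esub> y"
      by (auto simp: connected_def strongly_connected_def)
    then show "y \<in> verts (weak_component G x)"
      using assms(1) unfolding verts_weak_component
      by (blast intro: pre_digraph.reachable_mono subgraph_mk_symmetric)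
  qed
  show "arcs H \<subseteq> arcs (weak_component G x)"
  proof
    fix e assume "e \<in> arcs H"
    then have "head H e \<in> verts (weak_component G x)" "e \<in> arcs G"
      using verts assms(1) by auto
    moreover have "head H = head G" using assms(1) by (simp add: subgraph_def compatible_def)
    ultimately show "e \<in> arcs (weak_component G x)" by (simp add: arc_in_weak_component)
  qed
  show "compatible (weak_component G x) H"
    using assms(1) subgraph_weak_component by (auto simp: subgraph_def compatible_def)
  show "wf_digraph H" ..
  show "wf_digraph (weak_component G x)" using subgraph_weak_component by blast
qed

lemma subgraph_antisym:
  assumes "subgraph (H :: ('a, 'b) pre_digraph) H'" "subgraph H' H"
  shows "H = H'"
  using assms by (intro pre_digraph.equality) (auto simp: subgraph_def compatible_def)

text \<open>\<open>H\<close> lies inside \<open>weak_component G x\<close>, itself a connected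
  subgraph, so maximality of \<open>H\<close> forces equality.\<close>

lemma components_eq_weak_component:
  assumes "H \<in> components G" "x \<in> verts H"
  shows "H = weak_component G x"
proof -
  have H: "subgraph H G" "connected H"
    and max: "\<And>H'. H' \<noteq> H \<Longrightarrow> subgraph H H' \<Longrightarrow> \<not> (subgraph H' G \<and> connected H')"
    using assms(1) by (auto simp: components_def max_subgraph_def)
  have "x \<in> verts G" using H(1) assms(2) by auto
  then show ?thesis
    using max connected_subgraph_weak_component[OF H assms(2)] subgraph_weak_component
      connected_weak_component by metis
qed

lemma weak_component_in_components:
  assumes "x \<in> verts G"
  shows "weak_component G x \<in> components G"
proof -
  have "x \<in> verts (weak_component G x)" using assms by (rule in_weak_component_self)
  then have "H' = weak_component G x"
    if "subgraph (weak_component G x) H'" "subgraph H' G" "connected H'" for H'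
    using that connected_subgraph_weak_component[of H' x] by (blast intro: subgraph_antisym)
  then show ?thesis
    using assms subgraph_weak_component connected_weak_component
    unfolding components_def max_subgraph_def by blast
qed

section \<open>Arborescences and spanning forests\<close>

text \<open>A walk that repeats a vertex contains a closed subwalk and hence a cycle. Thus
  uniqueness of paths becomes usable for walks.\<close>

lemma circuit_free_awalk_imp_apath:
  assumes "circuit_free G" "awalk u p v"
  shows "apath u p v"
proof (rule ccontr)
  assume "\<not> apath u p v"
  with assms(2) obtain r where "closed_w r"
    by (auto simp: apath_def elim: awalk_cyc_decompE'[OF assms(2)])
  with assms(1) show False using closed_w_imp_cycle by (auto simp: circuit_free_def)
qed

lemma circuit_free_acyclic:
  assumes "circuit_free G"
  shows "acyclic (arcs_ends G)"
proof (rule acyclicI, intro allI notI)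
  fix x assume "x \<rightarrow>\<^sup>+ x"
  then obtain p where "closed_w p" by (auto simp: reachable1_awalk closed_w_def)
  with assms show False using closed_w_imp_cycle by (auto simp: circuit_free_def)
qed

text \<open>Walks from the root extended by \<open>a\<close> and by \<open>b\<close> are paths to
  the same vertex. They coincide, hence so do their last arcs.\<close>

lemma arborescence_in_arc_unique:
  assumes "arborescence G" "a \<in> arcs G" "b \<in> arcs G" "head G a = head G b"
  shows "a = b"
proof -
  have cf: "circuit_free G" using assms(1) by (simp add: arborescence_def)
  obtain r where r: "is_root G r" and
    uniq: "\<And>i. i \<in> verts G - {r} \<Longrightarrow> \<exists>!p. apath r p i"
    using assms(1) by (auto simp: arborescence_def)
  have walk: "\<exists>p. awalk r (p @ [e]) (head G e)" if "e \<in> arcs G" for e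
  proof -
    have "r \<rightarrow>\<^sup>* tail G e" using r that by (cases "tail G e = r") (auto simp: is_root_def)
    then obtain p where "awalk r p (tail G e)" by (auto simp: reachable_awalk)
    moreover have "awalk (tail G e) [e] (head G e)" using that by (simp add: arc_implies_awalk)
    ultimately show ?thesis by (blast intro: awalk_appendI)
  qed
  obtain p q where pq: "awalk r (p @ [a]) (head G a)" "awalk r (q @ [b]) (head G a)"
    using walk[OF assms(2)] walk[OF assms(3)] assms(4) by auto
  \<comment> \<open>Unique paths are only granted to vertices other than the root; an arc into the
    root would close a circuit.\<close>
  have "head G a \<noteq> r"
  proof
    assume "head G a = r"
    with pq(1) have "closed_w (p @ [a])" by (auto simp: closed_w_def)
    then show False using cf closed_w_imp_cycle by (auto simp: circuit_free_def)
  qed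
  then have "p @ [a] = q @ [b]"
    using uniq[of "head G a"] assms(2) pq[THEN circuit_free_awalk_imp_apath[OF cf]] by auto
  then show ?thesis by simp
qed

lemma directed_forest_in_arc_unique:
  assumes "directed_forest G" "a \<in> arcs G" "b \<in> arcs G" "head G a = head G b"
  shows "a = b"
proof -
  let ?H = "weak_component G (head G a)"
  have "head G a \<in> verts ?H" using assms(2) by (simp add: in_weak_component_self)
  then have "a \<in> arcs ?H" "b \<in> arcs ?H"
    using assms(2-4) arc_in_weak_component by auto
  moreover have "arborescence ?H"
    using assms(1,2) weak_component_in_components by (auto simp: directed_forest_def)
  moreover have "wf_digraph ?H" "head ?H = head G"
    using subgraph_weak_component by (auto simp: weak_component_def)
  ultimately show ?thesis
    using assms(4) wf_digraph.arborescence_in_arc_unique[of ?H a b] by simp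
qed

text \<open>Every component is a single vertex. This supplies the first spanning forest in the
  existence proof for maximal ones.\<close>

lemma directed_forest_no_arcs:
  assumes "arcs G = {}"
  shows "directed_forest G"
  unfolding directed_forest_def
proof
  fix H assume H: "H \<in> components G"
  then have sub: "subgraph H G" and conn: "connected H"
    by (auto simp: components_def max_subgraph_def)
  have no_arcs: "arcs H = {}" using sub assms by auto
  interpret H: wf_digraph H using sub by blast
  have adj: "arcs_ends H = {}" "parcs (mk_symmetric H) = {}"
    using no_arcs by (auto simp: arcs_ends_conv parcs_mk_symmetric)
  then have reach: "u = v" if "u \<rightarrow>\<^sup>*\<^bsub>mk_symmetric H\<^esub> v" for u v
    using that by (auto dest: reachable_rtranclI)
  obtain x where x: "x \<in> verts H"
    using conn by (auto simp: connected_def strongly_connected_def)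
  with conn reach have verts: "verts H = {x}"
    by (auto simp: connected_def strongly_connected_def)
  have "circuit_free H"
    using no_arcs by (auto simp: circuit_free_def H.cycle_def H.awalk_def)
  moreover have "is_root H r \<longleftrightarrow> r = x" for r
    using verts by (auto simp: is_root_def)
  ultimately show "arborescence H"
    using conn verts by (simp add: arborescence_def)
qed

end

section \<open>Finiteness and existence of maximal spanning forests\<close>

lemma spanning_iff:
  assumes "pair_wf_digraph G"
  shows "spanning (with_proj F) (with_proj G) \<longleftrightarrow> pverts F = pverts G \<and> parcs F \<subseteq> parcs G"
proof -
  have "pair_wf_digraph F" if "pverts F = pverts G" "parcs F \<subseteq> parcs G"
    using that assms unfolding pair_wf_digraph_def by (metis subsetD)
  then show ?thesis
    using assms by (auto simp: spanning_def subgraph_def wf_digraph_wp_iff)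
qed

context pair_fin_digraph
begin

lemma finite_max_spanning_forests: "finite (max_spanning_forests G)"
proof (rule finite_subset)
  show "max_spanning_forests G \<subseteq> (\<lambda>A. \<lparr>pverts = pverts G, parcs = A\<rparr>) ` Pow (parcs G)"
    by (auto simp: max_spanning_forests_def spanning_forest_def
        spanning_iff[OF pair_wf_digraph_axioms] image_iff intro!: pair_pre_digraph.equality)
qed (use pair_finite_arcs in auto)

text \<open>A spanning forest with the largest number of arcs is maximal: an admissible further arc
  would yield one with more arcs. The number of arcs of \<open>G\<close> bounds this count.\<close>

lemma max_spanning_forests_nonempty: "max_spanning_forests G \<noteq> {}"
proof -
  note sp = spanning_forest_def spanning_iff[OF pair_wf_digraph_axioms]
  let ?P = "\<lambda>F. spanning_forest F G"
  let ?E = "\<lparr>pverts = pverts G, parcs = {}\<rparr>"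
  have "wf_digraph (with_proj ?E)" by (simp add: wf_digraph_wp_iff pair_wf_digraph_def)
  then have E: "?P ?E" by (auto simp: sp intro: wf_digraph.directed_forest_no_arcs)
  have bound: "card (parcs F) < Suc (card (parcs G))" if "?P F" for F
    using that pair_finite_arcs by (auto simp: sp less_Suc_eq_le intro: card_mono)
  obtain F where F: "?P F" and max: "\<And>F'. ?P F' \<Longrightarrow> card (parcs F') \<le> card (parcs F)"
    using ex_has_greatest_nat[of ?P ?E "\<lambda>F. card (parcs F)", OF E] bound by (metis less_imp_le)
  have "\<not> directed_forest (with_proj (F\<lparr>parcs := insert a (parcs F)\<rparr>))"
    if a: "a \<in> parcs G - parcs F" for a
  proof
    assume "directed_forest (with_proj (F\<lparr>parcs := insert a (parcs F)\<rparr>))"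
    with a F have "?P (F\<lparr>parcs := insert a (parcs F)\<rparr>)" by (auto simp: sp)
    from max[OF this] have "card (insert a (parcs F)) \<le> card (parcs F)" by simp
    moreover have "finite (parcs F)"
      using F finite_subset[OF _ pair_finite_arcs] by (simp add: sp)
    ultimately show False using a by simp
  qed
  with F show ?thesis by (auto simp: max_spanning_forests_def)
qed

end

section \<open>Marginals of a forest\<close>

text \<open>One set is split off at a time; \<open>v {} = 0\<close> settles the empty
  family.\<close>

lemma superadditive_sum_le:
  assumes "superadditive N v" "v {} = 0" "finite R"
    and "\<And>r. r \<in> R \<Longrightarrow> T r \<subseteq> N" "disjoint_family_on T R"
  shows "(\<Sum>r\<in>R. v (T r)) \<le> v (\<Union>r\<in>R. T r)"
  using assms(3-5)
proof (induct R rule: finite_induct)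
  case empty
  then show ?case using assms(2) by simp
next
  case (insert x R)
  have "T x \<inter> (\<Union>r\<in>R. T r) = {}"
    using insert(2,5) by (fastforce simp: disjoint_family_on_def)
  moreover have "(\<Union>r\<in>R. T r) \<subseteq> N" "T x \<subseteq> N" using insert(4) by auto
  ultimately have "v (T x) + v (\<Union>r\<in>R. T r) \<le> v (T x \<union> (\<Union>r\<in>R. T r))"
    using assms(1) by (simp add: superadditive_def)
  moreover have "(\<Sum>r\<in>R. v (T r)) \<le> v (\<Union>r\<in>R. T r)"
    using insert by (auto simp: disjoint_family_on_def)
  ultimately show ?case using insert(1,2) by simp
qed

text \<open>Steps backwards from \<open>x\<close> are forced, so of two walks into \<open>x\<close>
  one is a final segment of the other. A start without predecessors cannot be passed, so the walks
  begin at the same point.\<close>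

lemma single_valued_converse_source_unique:
  assumes "single_valued (E\<inverse>)" "(r, x) \<in> E\<^sup>*" "(s, x) \<in> E\<^sup>*"
    and "r \<notin> Range E" "s \<notin> Range E"
  shows "r = s"
  using assms(2,3)
proof (induct rule: rtrancl_induct)
  case base
  then show ?case using assms(4) by (auto elim: rtranclE)
next
  case (step y z)
  from step(4) show ?case
  proof (cases rule: rtranclE)
    case base
    then show ?thesis using step(2) assms(5) by auto
  next
    case (step w)
    then have "w = y" using \<open>(y, z) \<in> E\<close> assms(1) by (auto dest: single_valuedD)
    then show ?thesis using step step.hyps(3) by auto
  qed
qed

text \<open>Going backwards from \<open>x\<close> must stop by well-foundedness, and it stops
  outside \<open>Range E\<close>.\<close>

lemma wf_source_exists:
  assumes "wf E"
  shows "\<exists>r. r \<notin> Range E \<and> (r, x) \<in> E\<^sup>*"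
  using assms
proof (induct x rule: wf_induct_rule)
  case (less x)
  then show ?case
    by (cases "x \<in> Range E") (blast intro: rtrancl_into_rtrancl)+
qed

text \<open>The bound for one forest, stated for its arc relation \<open>E\<close> alone. The roots
  in \<open>C\<close> are \<open>C - Range E\<close>, and the image of \<open>{i}\<close> under
  \<open>E\<^sup>*\<close> is the subtree at \<open>i\<close>.\<close>

lemma sum_marginals_le:
  assumes v: "superadditive N v" "v {} = 0"
    and C: "finite C" "C \<subseteq> N" "\<And>i j. (i, j) \<in> E \<Longrightarrow> i \<in> C \<longleftrightarrow> j \<in> C"
    and E: "wf E" "single_valued (E\<inverse>)"
  shows "(\<Sum>i\<in>C. v (E\<^sup>* `` {i}) - (\<Sum>j\<in>E `` {i}. v (E\<^sup>* `` {j}))) \<le> v C"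
proof -
  let ?f = "\<lambda>i. v (E\<^sup>* `` {i})"
  let ?R = "C - Range E"
  have closed: "i \<in> C \<longleftrightarrow> j \<in> C" if "(i, j) \<in> E\<^sup>*" for i j
    using that by (induct rule: rtrancl_induct) (use C(3) in auto)
  have nonroots: "(\<Union>i\<in>C. E `` {i}) = C \<inter> Range E" using C(3) by auto
  have fin: "finite (E `` {i})" if "i \<in> C" for i
    using that C(3) by (intro finite_subset[OF _ C(1)]) auto
  \<comment> \<open>Different points share no immediate successor, as \<open>E\<inverse>\<close> is
    single-valued, so the double sum counts each non-root of \<open>C\<close> once.\<close>
  have "(\<Sum>i\<in>C. \<Sum>j\<in>E `` {i}. ?f j) = (\<Sum>j\<in>(\<Union>i\<in>C. E `` {i}). ?f j)"
    using C(1) fin E(2) by (intro sum.UNION_disjoint[symmetric]) (auto dest: single_valuedD)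
  then have "(\<Sum>i\<in>C. ?f i - (\<Sum>j\<in>E `` {i}. ?f j)) = sum ?f C - sum ?f (C \<inter> Range E)"
    by (simp add: sum_subtractf nonroots)
  also have "\<dots> = sum ?f ?R"
    using sum.Int_Diff[OF C(1), of ?f "Range E"] by simp
  also have "\<dots> \<le> v (\<Union>r\<in>?R. E\<^sup>* `` {r})"
  proof (rule superadditive_sum_le[OF v])
    show "disjoint_family_on (\<lambda>r. E\<^sup>* `` {r}) ?R"
      using single_valued_converse_source_unique[OF E(2)] by (auto simp: disjoint_family_on_def)
  qed (use C closed in auto)
  \<comment> \<open>The source above a point of \<open>C\<close> is again in \<open>C\<close> by
    \<open>closed\<close>, so the trees rooted in \<open>?R\<close> cover \<open>C\<close>.\<close>
  also have "(\<Union>r\<in>?R. E\<^sup>* `` {r}) = C"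
    using closed wf_source_exists[OF E(1)] by fastforce
  finally show ?thesis .
qed

lemma marginal_eq:
  "marginal v F i = v ((parcs F)\<^sup>* `` {i}) - (\<Sum>j\<in>parcs F `` {i}. v ((parcs F)\<^sup>* `` {j}))"
proof -
  have "closed_successors F j = (parcs F)\<^sup>* `` {j}" for j
    by (auto simp: closed_successors_def successors_def rtrancl_eq_or_trancl)
  moreover have "immediate_successors F i = parcs F `` {i}"
    by (auto simp: immediate_successors_def)
  ultimately show ?thesis by (simp add: marginal_def)
qed

lemma sum_marginal_component_le:
  assumes os: "organisational_situation N v G"
    and F: "spanning_forest F G"
    and C: "C \<in> components (with_proj G)"
  shows "(\<Sum>i\<in>verts C. marginal v F i) \<le> v (verts C)"
proof -
  interpret G: pair_digraph G using os by (simp add: organisational_situation_def)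
  have v: "superadditive N v" "v {} = 0" and N: "pverts G = N" and cf: "circuit_free (with_proj G)"
    using os by (auto simp: organisational_situation_def tu_game_def)
  have sub: "parcs F \<subseteq> parcs G" and wfF: "wf_digraph (with_proj F)"
    and forest: "directed_forest (with_proj F)"
    using F by (auto simp: spanning_forest_def spanning_def subgraph_def)
  have CG: "subgraph C (with_proj G)" "connected C"
    using C by (auto simp: components_def G.max_subgraph_def)
  obtain x where "x \<in> verts C" using CG(2) by (auto simp: connected_def strongly_connected_def)
  with C have C_eq: "C = weak_component (with_proj G) x"
    by (rule G.components_eq_weak_component)
  have CN: "verts C \<subseteq> N" using subgraph_imp_subverts[OF CG(1)] N by simp
  \<comment> \<open>Acyclicity is inherited from \<open>G\<close>; finiteness turns it into
    well-foundedness.\<close>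
  have "wf (parcs F)"
  proof (rule finite_acyclic_wf)
    show "finite (parcs F)" using sub G.pair_finite_arcs by (rule finite_subset)
    show "acyclic (parcs F)" using G.circuit_free_acyclic[OF cf] sub by (rule acyclic_subset)
  qed
  moreover have "single_valued ((parcs F)\<inverse>)"
    using wf_digraph.directed_forest_in_arc_unique[OF wfF forest] by (force intro: single_valuedI)
  \<comment> \<open>\<open>C\<close> is a component of \<open>G\<close> and may contain several
    trees of \<open>F\<close>; it is closed under arcs of \<open>F\<close> because these are arcs of
    \<open>G\<close>.\<close>
  moreover have "i \<in> verts C \<longleftrightarrow> j \<in> verts C" if "(i, j) \<in> parcs F" for i j
    using G.weak_component_closed[of "(i, j)" x] that sub C_eq by auto
  moreover have "finite (verts C)" using CN N G.pair_finite_verts by (auto intro: finite_subset)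
  ultimately show ?thesis
    unfolding marginal_eq using v CN by (intro sum_marginals_le) auto
qed

theorem proposition1:
  fixes n :: nat
    and v :: "nat set \<Rightarrow> real"
    and \<Gamma> :: "nat pair_pre_digraph"
    and C :: "(nat, nat \<times> nat) pre_digraph"
  assumes "n \<ge> 2"
    and "organisational_situation {1..n} v \<Gamma>"
    and "C \<in> components (with_proj \<Gamma>)"
  shows "(\<Sum>i \<in> verts C. average_forest_measure v \<Gamma> i) \<le> v (verts C)"
proof -
  interpret pair_digraph \<Gamma> using assms(2) by (simp add: organisational_situation_def)
  let ?M = "max_spanning_forests \<Gamma>"
  have card: "card ?M > 0"
    using finite_max_spanning_forests max_spanning_forests_nonempty by (simp add: card_gt_0_iff)
  \<comment> \<open>With the sums exchanged, the bound applies to one forest at a time, and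
    positivity of \<open>card ?M\<close> allows division at the end.\<close>
  have "(\<Sum>i\<in>verts C. \<Sum>F\<in>?M. marginal v F i) = (\<Sum>F\<in>?M. \<Sum>i\<in>verts C. marginal v F i)"
    by (rule sum.swap)
  also have "\<dots> \<le> real (card ?M) * v (verts C)"
    using sum_marginal_component_le[OF assms(2) _ assms(3)]
    by (intro sum_bounded_above) (auto simp: max_spanning_forests_def)
  finally show ?thesis
    using card unfolding average_forest_measure_def sum_distrib_left[symmetric]
    by (simp add: field_simps)
qed

end
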